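(* Let $n \ge 2$ be an integer and let $S$ be a dense subset of $\mathbb{C}$ which is closed under powering. Then $\mathcal{M}_n(S)$ is dense in $\mathbb{C}^n$.
   Context: A subset $S$ of a ring $R$ is closed under powering if for any $\alpha \in S$ we also have $\alpha^m \in S$ for every non-zero integer $m$ (for $\alpha = 0$ this is required only for positive $m$, where $\alpha^m$ is defined). A vector $\mathbf{v}=(v_1,\dots,v_n)\in\mathbb{C}^n$ is multiplicatively dependent if all its coordinates are non-zero and there is a non-zero integer vector $(k_1,\dots,k_n)\in\mathbb{Z}^n$ with $v_1^{k_1}\cdots v_n^{k_n}=1$. For $S\subseteq\mathbb{C}$, $\mathcal{M}_n(S)$ denotes the set of multiplicatively dependent vectors in $\mathbb{C}^n$ all of whose coordinates lie in $S$. *)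

theory Defs
  imports "HOL-Analysis.Analysis"
begin

(* A division ring is the setting in which every negative power of a non-zero
   element is defined.  The disjunction excludes the undefined negative powers of 0. *)
definition closed_under_powering :: "'a::division_ring set \<Rightarrow> bool" where
  "closed_under_powering S \<longleftrightarrow>
     (\<forall>a\<in>S. \<forall>m::int. m \<noteq> 0 \<and> (a \<noteq> 0 \<or> m > 0) \<longrightarrow> a powi m \<in> S)"

definition mult_dependent :: "complex ^ 'n \<Rightarrow> bool" where
  "mult_dependent v \<longleftrightarrow>
     (\<forall>i. v $ i \<noteq> 0) \<and> (\<exists>k :: int ^ 'n. k \<noteq> 0 \<and> (\<Prod>i\<in>UNIV. (v $ i) powi (k $ i)) = 1)"

definition mult_dependent_vectors :: "complex set \<Rightarrow> (complex ^ 'n) set" where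
  "mult_dependent_vectors S = {v. mult_dependent v \<and> (\<forall>i. v $ i \<in> S)}"

end

theory Submission
  imports Defs "HOL-Number_Theory.Cong"
begin

text \<open>
  Two coordinates are enough to create a dependence: \<open>(a ^ p, a ^ q)\<close> is multiplicatively dependent.
  Such pairs with \<open>a \<in> S\<close> come close to any \<open>(z, w)\<close> with \<open>z, w \<noteq> 0\<close> and \<open>\<bar>z\<bar> \<noteq> 1\<close>. Indeed, let \<open>p\<close>
  be a large prime, \<open>q\<close> an integer prime to \<open>p\<close> with \<open>q / p\<close> close to \<open>ln \<bar>w\<bar> / ln \<bar>z\<bar>\<close>, and \<open>a\<close> a
  \<open>p\<close>-th root of \<open>z\<close>. Then \<open>\<bar>a ^ q\<bar>\<close> is close to \<open>\<bar>w\<bar>\<close>, and as \<open>a\<close> runs through all \<open>p\<close>-th roots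
  the argument of \<open>a ^ q\<close> takes all values of a coset of \<open>(2 * pi / p) \<int>\<close>, one of which is close to
  the argument of \<open>w\<close>. Finally \<open>a\<close> can be moved into the dense set \<open>S\<close> by continuity of powers.
\<close>

lemma int_near_not_dvd:
  fixes x :: real and p :: int
  assumes "p > 1"
  obtains q :: int where "\<not> p dvd q" "\<bar>of_int q - x\<bar> \<le> 1"
proof (cases "p dvd \<lfloor>x\<rfloor>")
  case True
  then have "\<not> p dvd \<lfloor>x\<rfloor> + 1"
    using assms by (simp add: dvd_add_right_iff)
  moreover have "\<bar>of_int (\<lfloor>x\<rfloor> + 1) - x\<bar> \<le> 1"
    by linarith
  ultimately show ?thesis
    by (rule that)
next
  case False
  moreover have "\<bar>of_int \<lfloor>x\<rfloor> - x\<bar> \<le> 1"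
    by linarith
  ultimately show ?thesis
    by (rule that)
qed

text \<open>Rounding \<open>p k * x\<close> to a nearby integer costs at most 1, and division by
  \<open>p k > k\<close> makes this error vanish. It serves twice: for the modulus through
  \<open>q k / p k\<close>, for the argument through \<open>j k / p k\<close>.\<close>

lemma tendsto_int_quotient:
  fixes m :: "nat \<Rightarrow> int" and p :: "nat \<Rightarrow> nat" and x :: real
  assumes "\<And>k. p k > k" and "\<And>k. \<bar>of_int (m k) - real (p k) * x\<bar> \<le> 1"
  shows "(\<lambda>k. of_int (m k) / real (p k)) \<longlonglongrightarrow> x"
proof (rule LIM_zero_cancel, rule Lim_null_comparison)
  show "(\<lambda>k. 1 / real (Suc k)) \<longlonglongrightarrow> 0"
    using LIMSEQ_inverse_real_of_nat by (simp add: inverse_eq_divide)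
  show "\<forall>\<^sub>F k in sequentially. norm (of_int (m k) / real (p k) - x) \<le> 1 / real (Suc k)"
  proof (intro always_eventually allI)
    fix k
    have p: "real (p k) \<ge> real (Suc k)" "real (p k) > 0"
      using assms(1)[of k] by linarith+
    then have "of_int (m k) / real (p k) - x = (of_int (m k) - real (p k) * x) / real (p k)"
      by (simp add: field_simps)
    then have "norm (of_int (m k) / real (p k) - x) \<le> 1 / real (p k)"
      using assms(2)[of k] p by (simp add: divide_right_mono)
    also have "\<dots> \<le> 1 / real (Suc k)"
      using p by (intro divide_left_mono) auto
    finally show "norm (of_int (m k) / real (p k) - x) \<le> 1 / real (Suc k)" .
  qed
qed

text \<open>The p-th roots of \<open>exp \<alpha>\<close> are
  \<open>exp ((\<alpha> + 2 pi i m) / p)\<close>. The choice of \<open>m\<close> turns the q-th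
  power by the angle \<open>2 pi q m / p\<close>. As \<open>q\<close> is invertible modulo
  \<open>p\<close>, some \<open>m\<close> makes this \<open>2 pi j / p\<close> up to full
  turns.\<close>

lemma exp_common_root_powers:
  fixes \<alpha> :: complex and p :: nat and q j :: int
  assumes "prime p" "\<not> int p dvd q"
  shows "\<exists>a. a \<noteq> 0 \<and> a powi int p = exp \<alpha> \<and>
    a powi q = exp (of_real (of_int q / real p) * \<alpha> + of_real (2 * pi * (of_int j / real p)) * \<i>)"
proof -
  have p: "p > 0"
    using assms(1) prime_gt_0_nat by blast
  have "coprime q (int p)"
    using assms by (metis coprime_commute prime_imp_coprime prime_nat_int_transfer)
  then obtain t where "[q * t = 1] (mod int p)"
    using cong_solve_coprime_int by blast
  then have "[q * t * j = 1 * j] (mod int p)"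
    by (rule cong_scalar_right)
  then obtain l where l: "q * (t * j) = j + int p * l"
    by (metis cong_iff_lin cong_sym mult.assoc mult.commute mult_1)
  \<comment> \<open>Since \<open>t\<close> inverts \<open>q\<close> modulo \<open>p\<close>,
    \<open>q * m = j + p * l\<close>; the term \<open>p * l\<close> contributes only
    \<open>l\<close> full turns to \<open>q * c\<close>.\<close>
  define m where "m = t * j"
  define c where "c = (\<alpha> + 2 * of_int m * pi * \<i>) / of_nat p"
  have period: "exp (x + 2 * of_int i * of_real pi * \<i>) = exp x" for x :: complex and i :: int
    using exp_integer_2pi[of "of_int i"] by (simp add: exp_add)
  have "of_int (int p) * c = \<alpha> + 2 * of_int m * of_real pi * \<i>"
    using p by (simp add: c_def)
  then have "exp c powi int p = exp \<alpha>"
    by (simp only: exp_power_int period)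
  moreover have "of_int q * c = of_real (of_int q / real p) * \<alpha>
      + of_real (2 * pi * (of_int j / real p)) * \<i> + 2 * of_int l * of_real pi * \<i>"
  proof -
    have "of_int q * of_int m = (of_int j + of_nat p * of_int l :: complex)"
      using l unfolding m_def by (metis of_int_add of_int_mult of_int_of_nat_eq)
    then have "of_int q * of_int m / of_nat p = (of_int j / of_nat p + of_int l :: complex)"
      using p by (simp add: field_simps)
    moreover have "of_int q * c
        = of_int q / of_nat p * \<alpha> + 2 * pi * \<i> * (of_int q * of_int m / of_nat p)"
      by (simp add: c_def add_divide_distrib algebra_simps)
    ultimately show ?thesis
      by (simp add: algebra_simps)
  qed
  then have "exp c powi q = exp (of_real (of_int q / real p) * \<alpha>
      + of_real (2 * pi * (of_int j / real p)) * \<i>)"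
    by (simp only: exp_power_int period)
  ultimately show ?thesis
    using exp_not_eq_zero by blast
qed

lemma common_root_powers_dense:
  fixes z w :: complex
  assumes "z \<noteq> 0" "norm z \<noteq> 1" "w \<noteq> 0" and "open A" "w \<in> A"
  shows "\<exists>a p q. a \<noteq> 0 \<and> p \<noteq> 0 \<and> q \<noteq> 0 \<and> a powi p = z \<and> a powi q \<in> A"
proof -
  define \<alpha> \<beta> where "\<alpha> = Ln z" and "\<beta> = Ln w"
  \<comment> \<open>\<open>\<rho>\<close> is \<open>ln |w| / ln |z|\<close>, the intended limit of
    \<open>q / p\<close>, with non-zero denominator as \<open>norm z \<noteq> 1\<close>;
    \<open>\<phi>\<close> is the argument by which \<open>\<rho> * \<alpha>\<close> still misses
    \<open>\<beta>\<close>.\<close>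
  define \<rho> where "\<rho> = Re \<beta> / Re \<alpha>"
  define \<phi> where "\<phi> = Im (\<beta> - of_real \<rho> * \<alpha>)"
  have "Re \<alpha> \<noteq> 0"
    using assms(1,2) by (simp add: \<alpha>_def)
  then have \<beta>: "\<beta> = of_real \<rho> * \<alpha> + of_real (2 * pi * (\<phi> / (2 * pi))) * \<i>"
    by (simp add: complex_eq_iff \<rho>_def \<phi>_def)
  have "\<forall>k. \<exists>p::nat. prime p \<and> p > k"
    using bigger_prime by blast
  then obtain p :: "nat \<Rightarrow> nat" where p: "\<And>k. prime (p k)" "\<And>k. p k > k"
    by metis
  have "\<exists>q. \<not> int (p k) dvd q \<and> \<bar>of_int q - real (p k) * \<rho>\<bar> \<le> 1" for k
    using int_near_not_dvd[of "int (p k)"] prime_gt_1_nat[OF p(1)[of k]]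
    by (metis of_nat_1 of_nat_less_iff)
  then obtain q where q: "\<And>k. \<not> int (p k) dvd q k"
      "\<And>k. \<bar>of_int (q k) - real (p k) * \<rho>\<bar> \<le> 1"
    by metis
  define j where "j k = \<lfloor>real (p k) * (\<phi> / (2 * pi))\<rfloor>" for k
  have j: "\<bar>of_int (j k) - real (p k) * (\<phi> / (2 * pi))\<bar> \<le> 1" for k
    unfolding j_def by linarith
  have "\<forall>k. \<exists>a. a \<noteq> 0 \<and> a powi int (p k) = exp \<alpha> \<and>
      a powi q k = exp (of_real (of_int (q k) / real (p k)) * \<alpha>
                        + of_real (2 * pi * (of_int (j k) / real (p k))) * \<i>)"
    using exp_common_root_powers[OF p(1) q(1)] by blast
  from choice[OF this] obtain a where a: "\<And>k. a k \<noteq> 0" "\<And>k. a k powi int (p k) = exp \<alpha>"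
      "\<And>k. a k powi q k = exp (of_real (of_int (q k) / real (p k)) * \<alpha>
                               + of_real (2 * pi * (of_int (j k) / real (p k))) * \<i>)"
    by blast
  have "(\<lambda>k. a k powi q k) \<longlonglongrightarrow> exp \<beta>"
    unfolding a(3) \<beta>
    by (intro tendsto_intros tendsto_int_quotient[OF p(2) q(2)] tendsto_int_quotient[OF p(2) j])
  moreover have "exp \<beta> \<in> A"
    using assms by (simp add: \<beta>_def)
  ultimately have "\<forall>\<^sub>F k in sequentially. a k powi q k \<in> A"
    using assms(4) by (metis topological_tendstoD)
  then obtain k where "a k powi q k \<in> A"
    by (meson eventually_sequentially order_refl)
  \<comment> \<open>\<open>q k\<close> is non-zero because 0 is a multiple of
    \<open>p k\<close>.\<close>
  moreover have "int (p k) \<noteq> 0" "q k \<noteq> 0" "exp \<alpha> = z"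
    using p(2)[of k] q(1)[of k] assms(1) by (auto simp: \<alpha>_def)
  ultimately show ?thesis
    using a(1,2) by metis
qed

lemma dense_meets_open:
  assumes "closure S = UNIV" "open U" "U \<noteq> {}"
  shows "\<exists>s. s \<in> S \<and> s \<in> U"
  using assms open_Int_closure_eq_empty[of U S] by auto

lemma dense_powers_meet_open:
  fixes S :: "complex set"
  assumes S: "closure S = UNIV"
    and A: "open A" "A \<noteq> {}" and B: "open B" "B \<noteq> {}"
  shows "\<exists>s p q. s \<in> S \<and> s \<noteq> 0 \<and> p \<noteq> 0 \<and> q \<noteq> 0 \<and> s powi p \<in> A \<and> s powi q \<in> B"
proof -
  \<comment> \<open>A null set contains no nonempty open set, which leaves room in \<open>A\<close>
    for a \<open>z\<close> off the origin and the unit circle.\<close>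
  have "negligible (insert 0 (sphere 0 1 :: complex set))"
    by (simp add: negligible_sphere)
  then have "\<not> A \<subseteq> insert 0 (sphere 0 1)"
    using A open_not_negligible negligible_subset by blast
  then obtain z where z: "z \<in> A" "z \<noteq> 0" "norm z \<noteq> 1"
    by (auto simp: subset_iff)
  have "\<not> B \<subseteq> {0}"
    using B open_not_negligible negligible_subset negligible_sing by blast
  then obtain w where w: "w \<in> B" "w \<noteq> 0"
    by auto
  obtain a p q where a: "a \<noteq> 0" "p \<noteq> 0" "q \<noteq> 0" "a powi p = z" "a powi q \<in> B"
    using common_root_powers_dense[OF z(2,3) w(2) B(1) w(1)] by blast
  \<comment> \<open>Negative powers are continuous only away from 0. Removing 0 keeps the preimages
    open and makes the point \<open>s\<close> found in them non-zero.\<close>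
  have "open ((\<lambda>x. x powi i) -` C \<inter> - {0})" if "open C" for i and C :: "complex set"
  proof -
    have "continuous_on (- {0}) (\<lambda>x::complex. x powi i)"
      by (intro continuous_intros) auto
    then show ?thesis
      using continuous_on_open_vimage[OF open_Compl[OF closed_singleton]] that by blast
  qed
  from this[OF A(1)] this[OF B(1)]
  have "open (((\<lambda>x. x powi p) -` A \<inter> - {0}) \<inter> ((\<lambda>x. x powi q) -` B \<inter> - {0}))"
    by (rule open_Int)
  moreover have "a \<in> ((\<lambda>x. x powi p) -` A \<inter> - {0}) \<inter> ((\<lambda>x. x powi q) -` B \<inter> - {0})"
    using a z by auto
  ultimately obtain s
    where "s \<in> S" "s \<in> ((\<lambda>x. x powi p) -` A \<inter> - {0}) \<inter> ((\<lambda>x. x powi q) -` B \<inter> - {0})"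
    using dense_meets_open[OF S] by blast
  then show ?thesis
    using a by blast
qed

text \<open>The relation is \<open>(s^p)^q * (s^q)^(-p) = 1\<close>, with exponent 0 at all other
  coordinates.\<close>

lemma mult_dependent_common_base:
  fixes v :: "complex ^ 'n"
  assumes "\<And>i. v $ i \<noteq> 0" "i0 \<noteq> i1" "p \<noteq> 0"
    and "v $ i0 = s powi p" "v $ i1 = s powi q"
  shows "mult_dependent v"
proof -
  define k :: "int ^ 'n" where "k = (\<chi> i. if i = i0 then q else if i = i1 then - p else 0)"
  have "s \<noteq> 0"
    using assms(1)[of i0] assms(3,4) by (metis power_int_0_left)
  have "(\<Prod>i\<in>UNIV. (v $ i) powi (k $ i)) = (\<Prod>i\<in>{i0, i1}. (v $ i) powi (k $ i))"
    by (rule prod.mono_neutral_right) (auto simp: k_def)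
  also have "\<dots> = s powi (p * q) * s powi (q * (- p))"
    using assms(2,4,5) by (simp add: k_def flip: power_int_mult)
  also have "\<dots> = 1"
    using \<open>s \<noteq> 0\<close> by (simp add: power_int_minus mult.commute)
  finally have "(\<Prod>i\<in>UNIV. (v $ i) powi (k $ i)) = 1" .
  moreover have "k $ i1 \<noteq> 0"
    using assms(2,3) by (simp add: k_def)
  then have "k \<noteq> 0"
    by auto
  ultimately show ?thesis
    using assms(1) unfolding mult_dependent_def by blast
qed

theorem theorem1p4:
  fixes S :: "complex set"
  assumes "CARD('n::finite) \<ge> 2"
    and "closure S = UNIV"
    and "closed_under_powering S"
  shows "closure (mult_dependent_vectors S :: (complex ^ 'n) set) = UNIV"
proof -
  obtain i0 i1 :: 'n where i: "i0 \<noteq> i1"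
    using assms(1) card_le_Suc0_iff_eq[of "UNIV :: 'n set"] by auto
  have "\<exists>u \<in> mult_dependent_vectors S. u \<in> U" if U: "open U" "v \<in> U"
    for U and v :: "complex ^ 'n"
  proof -
    obtain A where A: "\<And>i. open (A i)" "\<And>i. v $ i \<in> A i"
        and AU: "\<And>u. (\<forall>i. u $ i \<in> A i) \<Longrightarrow> u \<in> U"
      using U unfolding open_vec_def by metis
    have ne: "A i \<noteq> {}" for i
      using A(2) by blast
    obtain s p q where s: "s \<in> S" "s \<noteq> 0" "p \<noteq> 0" "q \<noteq> 0" "s powi p \<in> A i0" "s powi q \<in> A i1"
      using dense_powers_meet_open[OF assms(2) A(1) ne A(1) ne] by blast
    \<comment> \<open>The coordinates other than \<open>i0\<close> and \<open>i1\<close> are free: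
      any non-zero point of \<open>S\<close> in \<open>A i\<close> will do.\<close>
    have "\<exists>t. t \<in> S \<and> t \<in> A i - {0}" for i
    proof (rule dense_meets_open[OF assms(2)])
      show "open (A i - {0})"
        using A(1) by (simp add: open_delete)
      have "\<not> A i \<subseteq> {0}"
        using A(1,2)[of i] open_not_negligible negligible_subset negligible_sing by blast
      then show "A i - {0} \<noteq> {}"
        by blast
    qed
    then obtain t where t: "\<And>i. t i \<in> S" "\<And>i. t i \<in> A i" "\<And>i. t i \<noteq> 0"
      by (metis Diff_iff singletonI)
    define u :: "complex ^ 'n"
      where "u = (\<chi> i. if i = i0 then s powi p else if i = i1 then s powi q else t i)"
    \<comment> \<open>Closure under powering covers neither zeroth powers nor negative powers of 0,
      so \<open>p\<close>, \<open>q\<close> and \<open>s\<close> must be non-zero here.\<close>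
    have "s powi p \<in> S" "s powi q \<in> S"
      using assms(3) s unfolding closed_under_powering_def by blast+
    then have "\<forall>i. u $ i \<in> S" "\<forall>i. u $ i \<in> A i" "\<And>i. u $ i \<noteq> 0"
      using s t by (auto simp: u_def)
    moreover have "u $ i0 = s powi p" "u $ i1 = s powi q"
      using i by (simp_all add: u_def)
    ultimately have "u \<in> mult_dependent_vectors S" "u \<in> U"
      using mult_dependent_common_base i s(3) AU unfolding mult_dependent_vectors_def by blast+
    then show ?thesis
      by blast
  qed
  then show ?thesis
    unfolding set_eq_iff closure_iff_nhds_not_empty by blast
qed

end
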